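(* For every $m\ge 2$, the following program returns $G=R_m$, and at the end of the for loop $t=0$: set $G=[m-1]$ and $t=m-2$; for $j=1$ to $2^{m-2}-1$, let $v=v_2(j)$, append $[t,t+1,t+2,\ldots,t+v+1]\cup[t+v]$ to $G$, and then replace $t$ by $t+v-1$; return $G$.
   Context: $v_2(j)$ denotes the largest integer $v$ such that $2^v$ divides $j$. $\cup$ denotes concatenation of sequences. The sequences $R_m$ are defined by $R_2=[1]$ and $R_m=(R_{m-1}+1)\cup[1,2,\ldots,m-1]\cup R_{m-1}$ for $m\ge3$, where $R_{m-1}+1$ adds $1$ to each entry. *)

theory Defs
  imports "HOL-Computational_Algebra.Primes"
begin

text \<open>
  Sequences are lists of integers, so that none of the subtractions below is truncated.
  The values of \<open>R\<close> at \<open>0\<close> and \<open>1\<close> are irrelevant.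
\<close>

fun R :: "nat \<Rightarrow> int list" where
  "R m = (if m < 2 then []
          else if m = 2 then [1]
          else map (\<lambda>x. x + 1) (R (m - 1)) @ [1..int m - 1] @ R (m - 1))"

declare R.simps [simp del]

definition v2 :: "nat \<Rightarrow> nat" where
  "v2 j = multiplicity 2 j"

text \<open>
  The state of the program is the pair \<open>(G, t)\<close>; \<open>loop_body j\<close> is the \<open>j\<close>-th pass through
  the loop, in which the append uses the old value of \<open>t\<close>.
\<close>

fun loop_body :: "nat \<Rightarrow> int list \<times> int \<Rightarrow> int list \<times> int" where
  "loop_body j (G, t) =
     (let v = int (v2 j) in (G @ [t..t + v + 1] @ [t + v], t + v - 1))"

definition initial_state :: "nat \<Rightarrow> int list \<times> int" where
  "initial_state m = ([int m - 1], int m - 2)"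

definition final_state :: "nat \<Rightarrow> int list \<times> int" where
  "final_state m = fold loop_body [1..<2 ^ (m - 2)] (initial_state m)"

definition program_output :: "nat \<Rightarrow> int list" where
  "program_output m = fst (final_state m)"

end

theory Submission
  imports Defs
begin

text \<open>
  Since \<open>v\<^sub>2(2\<^sup>k + i) = v\<^sub>2(i)\<close> for \<open>0 < i < 2\<^sup>k\<close>, the passes before and after \<open>j = 2\<^sup>k\<close> act
  alike, up to the value of \<open>t\<close> at which they start. With \<open>m = k + 3\<close>, the first half starts
  one higher than for \<open>m - 1\<close> and so returns \<open>R\<^bsub>m-1\<^esub> + 1\<close> and \<open>t = 1\<close>; the pass \<open>j = 2\<^sup>k\<close>
  appends \<open>[1..m-1]\<close> together with the first entry \<open>m - 2\<close> of the final copy of \<open>R\<^bsub>m-1\<^esub>\<close>.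
\<close>

lemma v2_power_of_two: "v2 (2 ^ k) = k"
  unfolding v2_def by simp

text \<open>The power \<open>2 ^ v2 i\<close> divides \<open>i\<close>, so it lies below
  \<open>2 ^ k\<close>; unequal valuations make the sum take the smaller one.\<close>

lemma v2_add_power_of_two:
  assumes "0 < i" "i < 2 ^ k"
  shows "v2 (i + 2 ^ k) = v2 i"
proof -
  have "2 ^ multiplicity 2 i \<le> i"
    using assms(1) by (intro dvd_imp_le multiplicity_dvd)
  then have "(2::nat) ^ multiplicity 2 i < 2 ^ k"
    using assms(2) by linarith
  then have "multiplicity 2 i < multiplicity 2 ((2::nat) ^ k)"
    by simp
  then show ?thesis
    unfolding v2_def using assms(1) by (intro multiplicity_sum_lt) auto
qed

lemma R_2: "R 2 = [1]"
  by (simp add: R.simps)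

lemma R_Suc:
  assumes "m \<ge> 2"
  shows "R (Suc m) = map (\<lambda>x. x + 1) (R m) @ [1..int m] @ R m"
  using assms by (subst R.simps) simp

lemma fold_loop_body_shift:
  "fold loop_body [Suc (2 ^ k)..<2 ^ Suc k] = fold loop_body [1..<2 ^ k]"
proof -
  have "[Suc (2 ^ k)..<2 ^ Suc k] = map (\<lambda>i. i + 2 ^ k) [1..<2 ^ k]"
    by (rule nth_equalityI) auto
  moreover have "fold (loop_body \<circ> (\<lambda>i. i + 2 ^ k)) [1..<2 ^ k] = fold loop_body [1..<2 ^ k]"
    by (intro ext List.fold_cong refl) (auto simp: v2_add_power_of_two)
  ultimately show ?thesis
    by (simp add: fold_map)
qed

lemma upt_split_power_of_two:
  "[1..<2 ^ Suc k] = [1..<2 ^ k] @ 2 ^ k # [Suc (2 ^ k)..<2 ^ Suc k]"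
proof -
  have "[1..<2 ^ Suc k] = [1..<2 ^ k] @ [2 ^ k..<2 ^ Suc k]"
    using upt_add_eq_append[of 1 "2 ^ k" "2 ^ k"] by (simp add: mult_2)
  also have "[2 ^ k..<2 ^ Suc k] = (2 ^ k :: nat) # [Suc (2 ^ k)..<2 ^ Suc k]"
    by (intro upt_conv_Cons) simp
  finally show ?thesis .
qed

text \<open>The induction needs \<open>c\<close> and \<open>G\<close> free: the first half runs at
  offset \<open>c + 1\<close>, the second behind a longer prefix.\<close>

lemma fold_loop_body:
  "fold loop_body [1..<2 ^ k] (G @ [int k + 1 + c], int k + c) =
     (G @ map (\<lambda>x. x + c) (R (k + 2)), c)"
proof (induction k arbitrary: G c)
  case 0
  then show ?case
    using R_2 by (simp add: numeral_2_eq_2)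
next
  case (Suc k)
  let ?G = "G @ map (\<lambda>x. x + (c + 1)) (R (k + 2))"
  let ?G' = "?G @ [c + 1..c + 1 + int k + 1]"
  have first: "fold loop_body [1..<2 ^ k] (G @ [int (Suc k) + 1 + c], int (Suc k) + c)
      = (?G, c + 1)"
    using Suc.IH[of G "c + 1"] by (simp add: algebra_simps)
  \<comment> \<open>Here \<open>v = k\<close>, so the last entry \<open>t + v\<close> and the new
    \<open>t\<close> form the start state for offset \<open>c\<close>.\<close>
  have middle: "loop_body (2 ^ k) (?G, c + 1) = (?G' @ [int k + 1 + c], int k + c)"
    by (simp add: v2_power_of_two Let_def algebra_simps)
  have shift: "[c + 1..c + 1 + int k + 1] = map (\<lambda>x. x + c) [1..int (k + 2)]"
    by (rule nth_equalityI) auto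
  have "fold loop_body [1..<2 ^ Suc k] (G @ [int (Suc k) + 1 + c], int (Suc k) + c)
      = (?G' @ map (\<lambda>x. x + c) (R (k + 2)), c)"
    unfolding upt_split_power_of_two
    by (simp only: fold_append fold_simps comp_apply first middle fold_loop_body_shift Suc.IH)
  also have "?G' @ map (\<lambda>x. x + c) (R (k + 2)) = G @ map (\<lambda>x. x + c) (R (Suc k + 2))"
    unfolding shift using R_Suc[of "k + 2"] by (simp add: comp_def algebra_simps)
  finally show ?case .
qed

theorem theorem5p1:
  fixes m :: nat
  assumes "m \<ge> 2"
  shows "program_output m = R m \<and> snd (final_state m) = 0"
proof -
  obtain k where m: "m = k + 2"
    using assms by (metis add.commute le_Suc_ex)
  have "final_state m = (R m, 0)"
    using fold_loop_body[of k "[]" 0]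
    by (simp add: final_state_def initial_state_def m add.commute)
  then show ?thesis
    by (simp add: program_output_def)
qed

end
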